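(* Let $A\in\mathbb{R}^{m\times n}$ with $2\le m<n$ be a matrix with nonzero columns, let $b\in\mathbb{R}^m$, let $\phi:\mathbb{R}^m\to\mathbb{R}^m_{++}$ be a mapping, and let $\Phi_b=\mathrm{diag}(\phi(b))$. (i) Suppose that either $\alpha(\Phi_bA)\le\frac{1}{\mu(\Phi_bA)}$ and $\beta(\Phi_bA)<\alpha(\Phi_bA)$, or $\alpha(\Phi_bA)<\frac{1}{\mu(\Phi_bA)}$. If the system $Ax=b$ has a solution $x$ obeying $$\|x\|_0<\frac12\left[1+\frac{2\left(1-\alpha(\Phi_bA)\beta(\Phi_bA)\widetilde{\mu}(\Phi_bA)^2\right)}{\mu^{(2)}(\Phi_bA)\left\{\widetilde{\mu}(\Phi_bA)(\alpha(\Phi_bA)+\beta(\Phi_bA))+\sqrt{\left[\widetilde{\mu}(\Phi_bA)(\alpha(\Phi_bA)-\beta(\Phi_bA))\right]^2+4}\right\}}\right],$$ where $\widetilde{\mu}(\Phi_bA):=\mu(\Phi_bA)-\mu^{(2)}(\Phi_bA)$, then $x$ is the unique sparsest solution to the linear system. In particular, the same conclusion holds if $x$ obeys $$\|x\|_0<\frac12\left[1+\frac{1}{\mu(\Phi_bA)}+\left(\frac{1}{\mu^{(2)}(\Phi_bA)}-\frac{1}{\mu(\Phi_bA)}\right)(1-\alpha(\Phi_bA)\mu(\Phi_bA))\right].$$ (ii) If $\phi$ is chosen such that $\mu(\Phi_bA)<1$ and $\alpha(\Phi_bA)=1$, then a solution $x$ of $Ax=b$ satisfying $$\|x\|_0<\frac12\left[1+\frac{1}{\mu(\Phi_bA)}+\left(\frac{1}{\mu^{(2)}(\Phi_bA)}-\frac{1}{\mu(\Phi_bA)}\right)(1-\mu(\Phi_bA))\right]$$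 is the unique sparsest solution of the linear system.
   Context: $\mathbb{R}^m_{++}$ is the set of vectors in $\mathbb{R}^m$ with all components positive; $\mathrm{diag}(u)$ is the diagonal matrix with diagonal $u$. For a matrix $M\in\mathbb{R}^{m\times n}$ with nonzero columns $c_1,\dots,c_n$, put $g_{ij}=\frac{|c_i^Tc_j|}{\|c_i\|_2\|c_j\|_2}$. The mutual coherence is $\mu(M)=\max_{i\ne j}g_{ij}$. The sub-mutual coherence is $\mu^{(2)}(M)=\max\{g_{ij}: i\ne j,\ g_{ij}<\mu(M)\}$, the second largest distinct value among the $g_{ij}$, $i\neq j$ (convention: $0$ if this set is empty). It is known that $\mu^{(2)}(M)>0$ when $m<n$ and either $\alpha(M)<1/\mu(M)$, or $\alpha(M)\le 1/\mu(M)$ and $\beta(M)<\alpha(M)$. For $i=1,\dots,n$ let $\alpha_i(M)=|\{j: j\ne i,\ g_{ij}=\mu(M)\}|$. The coherence rank is $\alpha(M)=\max_{1\le i\le n}\alpha_i(M)$; let $i_0$ be an index with $\alpha_{i_0}(M)=\alpha(M)$; the sub-coherence rank is $\beta(M)=\max_{i\ne i_0}\alpha_i(M)$ (independent of the choice of $i_0$). $\|x\|_0$ is the number of nonzero components of $x$. A solution $x$ of $Ax=b$ is the unique sparsest solution if $\|x\|_0<\|y\|_0$ for every solution $y\ne x$ of $Ay=b$. *)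

theory Defs
  imports "HOL-Analysis.Analysis"
begin

definition diag_mat :: "real ^ 'm \<Rightarrow> real ^ 'm ^ 'm" where
  "diag_mat u = (\<chi> i j. if i = j then u $ i else 0)"

definition col_corr :: "real ^ 'n ^ 'm \<Rightarrow> 'n \<Rightarrow> 'n \<Rightarrow> real" where
  "col_corr M i j = \<bar>column i M \<bullet> column j M\<bar> / (norm (column i M) * norm (column j M))"

definition coherence :: "real ^ 'n ^ 'm \<Rightarrow> real" where
  "coherence M = Max {col_corr M i j |i j. i \<noteq> j}"

definition sub_coherence :: "real ^ 'n ^ 'm \<Rightarrow> real" where
  "sub_coherence M =
    (let S = {col_corr M i j |i j. i \<noteq> j \<and> col_corr M i j < coherence M}
     in if S = {} then 0 else Max S)"

definition coherence_gap :: "real ^ 'n ^ 'm \<Rightarrow> real" where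
  "coherence_gap M = coherence M - sub_coherence M"

definition col_rank :: "real ^ 'n ^ 'm \<Rightarrow> 'n \<Rightarrow> nat" where
  "col_rank M i = card {j. j \<noteq> i \<and> col_corr M i j = coherence M}"

definition coherence_rank :: "real ^ 'n ^ 'm \<Rightarrow> nat" where
  "coherence_rank M = Max (range (col_rank M))"

text \<open>The value does not depend on the chosen maximizing index; see
  \<open>sub_coherence_rank_eq\<close> below.\<close>

definition sub_coherence_rank :: "real ^ 'n ^ 'm \<Rightarrow> nat" where
  "sub_coherence_rank M =
    (let i0 = (SOME i. col_rank M i = coherence_rank M)
     in Max {col_rank M i |i. i \<noteq> i0})"

lemma sub_coherence_rank_eq:
  fixes M :: "real ^ 'n ^ 'm"
  assumes i0: "col_rank M i0 = coherence_rank M"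
  shows "sub_coherence_rank M = Max {col_rank M i |i. i \<noteq> i0}"
proof -
  define i1 where "i1 = (SOME i. col_rank M i = coherence_rank M)"
  have i1: "col_rank M i1 = coherence_rank M"
    unfolding i1_def using i0 by (rule someI)
  have le: "col_rank M i \<le> coherence_rank M" for i
    unfolding coherence_rank_def by (rule Max_ge) auto
  have "Max {col_rank M i |i. i \<noteq> i1} = Max {col_rank M i |i. i \<noteq> i0}"
  proof (cases "i1 = i0")
    case False
    have "Max {col_rank M i |i. i \<noteq> i1} = coherence_rank M"
      using False i0 le by (intro Max_eqI) (auto intro: exI[of _ i0])
    moreover have "Max {col_rank M i |i. i \<noteq> i0} = coherence_rank M"
      using False i1 le by (intro Max_eqI) (auto intro: exI[of _ i1])
    ultimately show ?thesis by simp
  qed simp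
  then show ?thesis
    unfolding sub_coherence_rank_def Let_def i1_def .
qed

definition l0_norm :: "real ^ 'n \<Rightarrow> nat" where
  "l0_norm x = card {i. x $ i \<noteq> 0}"

definition unique_sparsest_solution :: "real ^ 'n ^ 'm \<Rightarrow> real ^ 'm \<Rightarrow> real ^ 'n \<Rightarrow> bool" where
  "unique_sparsest_solution A b x \<longleftrightarrow>
    A *v x = b \<and> (\<forall>y. A *v y = b \<and> y \<noteq> x \<longrightarrow> l0_norm x < l0_norm y)"

end

theory Submission
  imports Defs
begin

text \<open>Two solutions differ by a kernel vector of \<open>A\<close>, and scaling the rows by the positive vector \<open>\<phi> b\<close>
does not change the kernel. So everything is about supports of nonzero kernel vectors \<open>z\<close> of \<open>M\<close>,
whose columns are nonzero.
Write \<open>\<mu>, \<nu>, \<delta> = \<mu> - \<nu>, \<alpha>, \<beta>\<close> for the coherence, the sub-coherence, their gap and the two ranks.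

Testing \<open>M *v z = 0\<close> against each column says that the Gram matrix of the normalised columns,
restricted to the support of \<open>z\<close>, is singular. Brauer's theorem on ovals of Cassini
(\<open>cassini_row_sums\<close>) then produces two distinct rows whose off-diagonal absolute row sums have
product at least 1. An off-diagonal entry is at most \<open>\<nu>\<close> unless it equals \<open>\<mu>\<close>, and the entries
of a row equal to \<open>\<mu>\<close> are counted by its rank; at most one of the two rows can have a rank exceeding
\<open>\<beta>\<close>. With \<open>t = l0_norm z - 1\<close> this gives (\<open>kernel_support_quadratic\<close>)
\<open>1 \<le> (\<nu> * t + \<delta> * \<alpha>) * (\<nu> * t + \<delta> * \<beta>)\<close>.

The first bound in (i) is half of one plus the larger root \<open>t\<close> of this quadratic, in rationalised
form. Replacing \<open>\<beta>\<close> by \<open>\<alpha>\<close> gives \<open>\<nu> * t \<ge> 1 - \<delta> * \<alpha>\<close>, which is the second bound. So in both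
cases twice the sparsity of \<open>x\<close> is below the size of any kernel support, and the difference of two
solutions cannot be that sparse. Since there are more columns than rows, a nonzero kernel
vector exists; it forces \<open>\<mu> > 0\<close>, and with \<open>\<nu> = 0\<close> the quadratic would read
\<open>1 \<le> \<mu>\<^sup>2 * \<alpha> * \<beta>\<close>, against the rank hypothesis, whence \<open>\<nu> > 0\<close>.
Part (ii) is the case \<open>\<alpha> = 1 < 1 / \<mu>\<close> of (i).\<close>

section \<open>Kernel supports and uniqueness\<close>

lemma l0_norm_diff_le: "l0_norm (x - y) \<le> l0_norm x + l0_norm y"
proof -
  have "card {i. (x - y) $ i \<noteq> 0} \<le> card ({i. x $ i \<noteq> 0} \<union> {i. y $ i \<noteq> 0})"
    by (intro card_mono) auto
  also have "\<dots> \<le> card {i. x $ i \<noteq> 0} + card {i. y $ i \<noteq> 0}"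
    by (rule card_Un_le)
  finally show ?thesis
    unfolding l0_norm_def .
qed

lemma unique_sparsest_solution_if_kernel_supports_large:
  assumes "A *v x = b"
    and large: "\<And>z. z \<noteq> 0 \<Longrightarrow> A *v z = 0 \<Longrightarrow> 2 * l0_norm x < l0_norm z"
  shows "unique_sparsest_solution A b x"
  unfolding unique_sparsest_solution_def
proof (intro conjI allI impI)
  fix y assume y: "A *v y = b \<and> y \<noteq> x"
  then have "A *v (x - y) = 0"
    using assms(1) by (simp add: matrix_vector_mult_diff_distrib)
  then have "2 * l0_norm x < l0_norm (x - y)"
    using y by (intro large) auto
  then show "l0_norm x < l0_norm y"
    using l0_norm_diff_le[of x y] by linarith
qed fact

lemma diag_mat_mult_vec: "diag_mat u *v v = (\<chi> i. u $ i * v $ i)"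
proof -
  have "(\<Sum>j\<in>UNIV. (if i = j then u $ i else 0) * v $ j) = u $ i * v $ i" for i
    by (simp add: if_distrib[of "\<lambda>c. c * _"] cong: if_cong)
  then show ?thesis
    by (simp add: diag_mat_def matrix_vector_mult_def vec_eq_iff)
qed

lemma diag_mat_mult_vec_eq_0_iff:
  assumes "\<forall>i. 0 < u $ i"
  shows "diag_mat u *v v = 0 \<longleftrightarrow> v = 0"
  using assms by (auto simp: diag_mat_mult_vec vec_eq_iff less_le)

section \<open>The Gram matrix on the support of a kernel vector\<close>

lemma col_corr_nonneg: "0 \<le> col_corr M i j"
  by (simp add: col_corr_def)

text \<open>Expand \<open>column i M \<bullet> (M *v z) = 0\<close> over the columns and divide by \<open>norm (column i M)\<close>; the
weights \<open>\<bar>z $ j\<bar> * norm (column j M)\<close> are what normalising the columns does to \<open>z\<close>.\<close>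

lemma kernel_weight_le:
  fixes M :: "real ^ 'n ^ 'm"
  assumes nz: "\<And>j. column j M \<noteq> 0" and ker: "M *v z = 0"
  defines "w \<equiv> \<lambda>j. \<bar>z $ j\<bar> * norm (column j M)"
  shows "w i \<le> (\<Sum>j\<in>UNIV - {i}. col_corr M i j * w j)"
proof -
  let ?c = "\<lambda>j. column j M"
  have term_eq: "\<bar>z $ j * (?c i \<bullet> ?c j)\<bar> = norm (?c i) * (col_corr M i j * w j)" for j
    using nz[of i] nz[of j] by (simp add: col_corr_def w_def abs_mult field_simps)
  have "0 = ?c i \<bullet> (\<Sum>j\<in>UNIV. z $ j *\<^sub>R ?c j)"
    using ker by (simp add: matrix_mult_sum scalar_mult_eq_scaleR)
  also have "\<dots> = (\<Sum>j\<in>UNIV. z $ j * (?c i \<bullet> ?c j))"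
    by (simp add: inner_sum_right)
  also have "\<dots> = z $ i * (?c i \<bullet> ?c i) + (\<Sum>j\<in>UNIV - {i}. z $ j * (?c i \<bullet> ?c j))"
    by (simp add: sum.remove[of UNIV i])
  finally have "\<bar>z $ i * (?c i \<bullet> ?c i)\<bar> = \<bar>\<Sum>j\<in>UNIV - {i}. z $ j * (?c i \<bullet> ?c j)\<bar>"
    by linarith
  also have "\<dots> \<le> (\<Sum>j\<in>UNIV - {i}. \<bar>z $ j * (?c i \<bullet> ?c j)\<bar>)"
    by (rule sum_abs)
  also have "\<dots> = norm (?c i) * (\<Sum>j\<in>UNIV - {i}. col_corr M i j * w j)"
    by (simp only: term_eq sum_distrib_left)
  finally have "norm (?c i) * w i \<le> norm (?c i) * (\<Sum>j\<in>UNIV - {i}. col_corr M i j * w j)"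
    by (simp add: w_def abs_mult dot_square_norm power2_eq_square mult_ac)
  then show ?thesis
    using nz[of i] by simp
qed

text \<open>Brauer's argument: choose \<open>i\<close> with the largest weight \<open>w i\<close> and \<open>j\<close> with the largest weight
among the rest of the support. Then \<open>w i \<le> R\<^sub>i * w j\<close> and \<open>w j \<le> R\<^sub>j * w i\<close> for the row sums \<open>R\<^sub>i, R\<^sub>j\<close>,
and multiplying the two cancels the weights.\<close>

lemma cassini_row_sums:
  fixes g :: "'n::finite \<Rightarrow> 'n \<Rightarrow> real" and w :: "'n \<Rightarrow> real"
  assumes g: "\<And>i j. 0 \<le> g i j"
    and w: "\<And>i. 0 \<le> w i"
    and dominated: "\<And>i. w i \<le> (\<Sum>j\<in>UNIV - {i}. g i j * w j)"
  defines "S \<equiv> {i. w i \<noteq> 0}"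
  assumes "S \<noteq> {}"
  obtains i j where "i \<in> S" "j \<in> S" "i \<noteq> j"
    "1 \<le> (\<Sum>k\<in>S - {i}. g i k) * (\<Sum>k\<in>S - {j}. g j k)"
proof -
  have wS: "w i \<le> (\<Sum>j\<in>S - {i}. g i j * w j)" for i
  proof -
    have "(\<Sum>j\<in>UNIV - {i}. g i j * w j) = (\<Sum>j\<in>S - {i}. g i j * w j)"
      by (rule sum.mono_neutral_right) (auto simp: S_def)
    then show ?thesis
      using dominated[of i] by simp
  qed
  have pos: "0 < w i" if "i \<in> S" for i
    using that w[of i] by (simp add: S_def)
  have exists_max: "\<exists>i\<in>T. \<forall>k\<in>T. w k \<le> w i" if "T \<noteq> {}" for T
    using that Max_in[of "w ` T"] Max_ge[of "w ` T"] by fastforce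
  obtain i where i: "i \<in> S" "\<And>k. k \<in> S \<Longrightarrow> w k \<le> w i"
    using exists_max[OF \<open>S \<noteq> {}\<close>] by blast
  have "S - {i} \<noteq> {}"
  proof
    assume "S - {i} = {}"
    then have "w i \<le> 0"
      using wS[of i] by (simp only: sum.empty)
    with pos[OF i(1)] show False
      by simp
  qed
  from exists_max[OF this] obtain j
    where j: "j \<in> S" "j \<noteq> i" "\<And>k. k \<in> S - {i} \<Longrightarrow> w k \<le> w j"
    by blast
  let ?R = "\<lambda>i. \<Sum>k\<in>S - {i}. g i k"
  have R: "w l \<le> ?R l * c" if "\<And>k. k \<in> S - {l} \<Longrightarrow> w k \<le> c" for l c
  proof -
    have "(\<Sum>k\<in>S - {l}. g l k * w k) \<le> (\<Sum>k\<in>S - {l}. g l k * c)"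
      by (intro sum_mono mult_left_mono that g)
    then show ?thesis
      using wS[of l] by (simp add: sum_distrib_right)
  qed
  have "w i * w j \<le> (?R i * w j) * (?R j * w i)"
    using i j w g by (intro mult_mono R mult_nonneg_nonneg sum_nonneg) auto
  also have "\<dots> = (w i * w j) * (?R i * ?R j)"
    by (simp add: mult_ac)
  finally have "1 \<le> ?R i * ?R j"
    using pos[OF i(1)] pos[OF j(1)] by simp
  with i(1) j(1,2) show thesis
    by (intro that[of i j]) auto
qed

section \<open>Row sums in terms of coherence and rank\<close>

lemma col_corr_le_coherence:
  assumes "i \<noteq> j"
  shows "col_corr M i j \<le> coherence M"
  unfolding coherence_def
proof (rule Max_ge)
  show "finite {col_corr M i j |i j. i \<noteq> j}"
    by (rule finite_subset[of _ "range (\<lambda>(i, j). col_corr M i j)"]) auto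
qed (use assms in blast)

lemma finite_sub_coherence_values:
  fixes M :: "real ^ 'n ^ 'm"
  shows "finite {col_corr M i j |i j. i \<noteq> j \<and> col_corr M i j < coherence M}"
  by (rule finite_subset[of _ "range (\<lambda>(i, j). col_corr M i j)"]) auto

lemma col_corr_le_sub_coherence:
  assumes "i \<noteq> j" "col_corr M i j < coherence M"
  shows "col_corr M i j \<le> sub_coherence M"
proof -
  let ?S = "{col_corr M i j |i j. i \<noteq> j \<and> col_corr M i j < coherence M}"
  have mem: "col_corr M i j \<in> ?S"
    using assms by blast
  then have "sub_coherence M = Max ?S"
    unfolding sub_coherence_def Let_def by (metis (lifting) empty_iff)
  then show ?thesis
    using Max_ge[OF finite_sub_coherence_values mem] by simp
qed

lemma sub_coherence_cases:
  obtains "sub_coherence M = 0"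
  | i j where "i \<noteq> j" "col_corr M i j < coherence M" "sub_coherence M = col_corr M i j"
proof (cases "{col_corr M i j |i j. i \<noteq> j \<and> col_corr M i j < coherence M} = {}")
  case True
  then show thesis
    using that(1) unfolding sub_coherence_def Let_def by (metis (lifting))
next
  case False
  then have "sub_coherence M \<in> {col_corr M i j |i j. i \<noteq> j \<and> col_corr M i j < coherence M}"
    using Max_in[OF finite_sub_coherence_values False]
    unfolding sub_coherence_def Let_def by (metis (lifting))
  then show thesis
    using that(2) by blast
qed

lemma sub_coherence_nonneg: "0 \<le> sub_coherence M"
  by (rule sub_coherence_cases[of M]) (auto simp: col_corr_nonneg)

text \<open>The two distinct indices only guarantee that there is an off-diagonal entry, so that the
coherence is nonnegative; this matters when the sub-coherence takes its default value 0.\<close>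

lemma coherence_gap_nonneg:
  fixes M :: "real ^ 'n ^ 'm"
  assumes "i \<noteq> (j :: 'n)"
  shows "0 \<le> coherence_gap M"
proof -
  have "0 \<le> coherence M"
    using col_corr_nonneg[of M i j] col_corr_le_coherence[OF assms, of M] by linarith
  then show ?thesis
    by (rule_tac sub_coherence_cases[of M]) (auto simp: coherence_gap_def)
qed

lemma col_rank_le_coherence_rank: "col_rank M i \<le> coherence_rank M"
  unfolding coherence_rank_def by (rule Max_ge) auto

lemma obtain_coherence_rank_index:
  obtains i where "col_rank M i = coherence_rank M"
proof -
  have "coherence_rank M \<in> range (col_rank M)"
    unfolding coherence_rank_def by (rule Max_in) auto
  then show thesis
    using that by (metis imageE)
qed

lemma col_rank_le_sub_coherence_rank:
  assumes "col_rank M i0 = coherence_rank M" "i \<noteq> i0"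
  shows "col_rank M i \<le> sub_coherence_rank M"
  unfolding sub_coherence_rank_eq[OF assms(1)] using assms(2) by (intro Max_ge) auto

lemma sub_coherence_rank_le_coherence_rank:
  fixes M :: "real ^ 'n ^ 'm"
  assumes "i \<noteq> (j :: 'n)"
  shows "sub_coherence_rank M \<le> coherence_rank M"
proof -
  obtain i0 where i0: "col_rank M i0 = coherence_rank M"
    by (rule obtain_coherence_rank_index)
  obtain k where "k \<noteq> i0"
    using assms by metis
  then show ?thesis
    unfolding sub_coherence_rank_eq[OF i0]
    by (intro Max.boundedI) (auto simp: col_rank_le_coherence_rank)
qed

lemma col_corr_row_sum_le:
  assumes "i \<in> S" "i \<noteq> j"
  shows "(\<Sum>k\<in>S - {i}. col_corr M i k)
    \<le> sub_coherence M * (real (card S) - 1) + coherence_gap M * real (col_rank M i)"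
proof -
  let ?m = "\<lambda>k. if col_corr M i k = coherence M then 1 else 0 :: real"
  have "col_corr M i k \<le> sub_coherence M + coherence_gap M * ?m k" if "k \<in> S - {i}" for k
    using that col_corr_le_coherence[of i k M] col_corr_le_sub_coherence[of i k M]
    by (auto simp: coherence_gap_def)
  then have "(\<Sum>k\<in>S - {i}. col_corr M i k)
      \<le> (\<Sum>k\<in>S - {i}. sub_coherence M + coherence_gap M * ?m k)"
    by (rule sum_mono)
  also have "\<dots> = sub_coherence M * real (card (S - {i})) + coherence_gap M * (\<Sum>k\<in>S - {i}. ?m k)"
    by (simp add: sum.distrib sum_distrib_left)
  also have "real (card (S - {i})) = real (card S) - 1"
    using assms(1) card_gt_0_iff[of S] by (auto simp: card_Diff_singleton of_nat_diff)
  also have "(\<Sum>k\<in>S - {i}. ?m k) \<le> (\<Sum>k\<in>UNIV - {i}. ?m k)"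
    by (intro sum_mono2) auto
  also have "(\<Sum>k\<in>UNIV - {i}. ?m k) = real (col_rank M i)"
    by (auto simp: col_rank_def sum.If_cases intro!: arg_cong[of _ _ card])
  finally show ?thesis
    using coherence_gap_nonneg[OF assms(2), of M] by (simp add: mult_left_mono)
qed

section \<open>The quadratic inequality for kernel supports\<close>

lemma kernel_support_quadratic:
  fixes M :: "real ^ 'n ^ 'm"
  assumes nz: "\<And>j. column j M \<noteq> 0" and z: "M *v z = 0" "z \<noteq> 0"
  defines "u \<equiv> sub_coherence M * (real (l0_norm z) - 1)"
  shows "1 \<le> (u + coherence_gap M * real (coherence_rank M))
              * (u + coherence_gap M * real (sub_coherence_rank M))"
    and "0 \<le> u"
    and "0 \<le> coherence_gap M"
    and "sub_coherence_rank M \<le> coherence_rank M"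
proof -
  let ?w = "\<lambda>j. \<bar>z $ j\<bar> * norm (column j M)"
  let ?S = "{i. ?w i \<noteq> 0}"
  let ?R = "\<lambda>i. \<Sum>k\<in>?S - {i}. col_corr M i k"
  let ?B = "\<lambda>r. u + coherence_gap M * real r"
  have S: "?S = {i. z $ i \<noteq> 0}"
    using nz by auto
  have "?S \<noteq> {}"
    using z(2) unfolding S by (auto simp: vec_eq_iff)
  then obtain i j where ij: "i \<in> ?S" "j \<in> ?S" "i \<noteq> j" and R: "1 \<le> ?R i * ?R j"
    using cassini_row_sums[of "col_corr M" ?w, OF col_corr_nonneg _ kernel_weight_le[OF nz z(1)]]
    by (metis (no_types, lifting) abs_ge_zero mult_nonneg_nonneg norm_ge_zero)
  show gap: "0 \<le> coherence_gap M"
    using ij(3) by (rule coherence_gap_nonneg)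
  show "sub_coherence_rank M \<le> coherence_rank M"
    using ij(3) by (rule sub_coherence_rank_le_coherence_rank)
  have "0 < l0_norm z"
    using ij(1) unfolding l0_norm_def S by (auto simp: card_gt_0_iff)
  then show u: "0 \<le> u"
    unfolding u_def by (intro mult_nonneg_nonneg sub_coherence_nonneg) linarith
  have RB: "?R k \<le> ?B (col_rank M k)" if "k \<in> ?S" "k \<noteq> l" for k l
    using col_corr_row_sum_le[OF that, of M] by (simp only: u_def l0_norm_def S)
  have B_mono: "?B r * ?B s \<le> ?B r' * ?B s'" if "r \<le> r'" "s \<le> s'" for r s r' s'
    using that gap u by (intro mult_mono add_left_mono mult_left_mono) auto
  have "1 \<le> ?B (col_rank M i) * ?B (col_rank M j)"
    using R mult_mono[OF RB[OF ij(1,3)] RB[OF ij(2) ij(3)[symmetric]]] gap u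
    by (smt (verit) col_corr_nonneg mult_nonneg_nonneg of_nat_0_le_iff sum_nonneg)
  also obtain i0 where i0: "col_rank M i0 = coherence_rank M"
    by (rule obtain_coherence_rank_index)
  \<comment> \<open>A row other than \<open>i0\<close> has rank at most the sub-coherence rank, and \<open>i\<close>, \<open>j\<close> are not both \<open>i0\<close>.\<close>
  have "?B (col_rank M i) * ?B (col_rank M j)
      \<le> ?B (coherence_rank M) * ?B (sub_coherence_rank M)"
  proof (cases "j = i0")
    case False
    then show ?thesis
      by (intro B_mono col_rank_le_coherence_rank col_rank_le_sub_coherence_rank[OF i0])
  next
    case True
    then have "?B (col_rank M j) * ?B (col_rank M i)
        \<le> ?B (coherence_rank M) * ?B (sub_coherence_rank M)"
      using ij(3)
      by (intro B_mono col_rank_le_coherence_rank col_rank_le_sub_coherence_rank[OF i0]) auto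
    then show ?thesis
      by (simp add: mult.commute)
  qed
  finally show "1 \<le> ?B (coherence_rank M) * ?B (sub_coherence_rank M)" .
qed

text \<open>Completing the square, \<open>4 * (u + p) * (u + q) = (2 * u + p + q)\<^sup>2 - (p - q)\<^sup>2\<close>, so
\<open>2 * u \<ge> D - (p + q)\<close> where \<open>D\<close> is the square root below. The quotient is half of \<open>D - (p + q)\<close>,
multiplied and divided by \<open>D + (p + q)\<close>.\<close>

lemma quadratic_root_le:
  fixes p q u :: real
  assumes "0 \<le> p" "0 \<le> q" "0 \<le> u" "1 \<le> (u + p) * (u + q)"
  shows "2 * (1 - p * q) / ((p + q) + sqrt ((p - q)\<^sup>2 + 4)) \<le> u"
proof -
  define D where "D = sqrt ((p - q)\<^sup>2 + 4)"
  have D2: "D\<^sup>2 = (p - q)\<^sup>2 + 4" and "0 < D"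
    unfolding D_def by (auto intro: add_nonneg_pos)
  have "(p - q)\<^sup>2 + 4 \<le> (2 * u + p + q)\<^sup>2"
    using assms(4) by (simp add: power2_eq_square algebra_simps)
  then have "D \<le> 2 * u + p + q"
    using assms unfolding D_def by (intro real_le_lsqrt) auto
  then have "(D - (p + q)) * (D + (p + q)) \<le> 2 * u * (D + (p + q))"
    using \<open>0 < D\<close> assms by (intro mult_right_mono) auto
  moreover have "(D - (p + q)) * (D + (p + q)) = 4 * (1 - p * q)"
    using D2 by (simp add: power2_eq_square algebra_simps)
  ultimately show ?thesis
    unfolding D_def[symmetric] using \<open>0 < D\<close> assms by (simp add: divide_le_eq algebra_simps)
qed

lemma one_le_if_prod_ge_1:
  fixes x y :: real
  assumes "1 \<le> x * y" "0 \<le> y" "y \<le> x"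
  shows "1 \<le> x"
proof (rule ccontr)
  assume "\<not> 1 \<le> x"
  then have "x * y < 1"
    using assms(2,3) mult_le_one[of x y] by (smt (verit) mult_less_cancel_right1)
  with assms(1) show False
    by simp
qed

text \<open>If the coherence were 0, the gap and the sub-coherence, which are nonnegative and add up to it,
would vanish as well, and the quadratic inequality would read \<open>1 \<le> 0\<close>.\<close>

lemma coherence_pos:
  fixes M :: "real ^ 'n ^ 'm"
  assumes nz: "\<And>j. column j M \<noteq> 0" and z: "M *v z = 0" "z \<noteq> 0"
  shows "0 < coherence M"
proof (rule ccontr)
  note quad = kernel_support_quadratic[OF nz z]
  assume "\<not> 0 < coherence M"
  then have "sub_coherence M = 0" "coherence_gap M = 0"
    using quad(3) sub_coherence_nonneg[of M] unfolding coherence_gap_def by linarith+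
  then show False
    using quad(1) by simp
qed

text \<open>A vanishing sub-coherence turns the quadratic inequality into \<open>1 \<le> (\<mu> * \<alpha>) * (\<mu> * \<beta>)\<close>, while
the hypothesis makes one of \<open>\<mu> * \<beta> \<le> \<mu> * \<alpha>\<close> and \<open>\<mu> * \<alpha> \<le> 1\<close> strict, so \<open>\<mu> * \<beta> < 1\<close>.\<close>

lemma sub_coherence_pos:
  fixes M :: "real ^ 'n ^ 'm"
  assumes nz: "\<And>j. column j M \<noteq> 0" and z: "M *v z = 0" "z \<noteq> 0"
    and rank: "real (coherence_rank M) \<le> 1 / coherence M \<and> sub_coherence_rank M < coherence_rank M
      \<or> real (coherence_rank M) < 1 / coherence M"
  shows "0 < sub_coherence M"
proof -
  note quad = kernel_support_quadratic[OF nz z]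
  let ?\<mu> = "coherence M" and ?\<alpha> = "real (coherence_rank M)"
    and ?\<beta> = "real (sub_coherence_rank M)"
  have \<mu>: "0 < ?\<mu>"
    using nz z by (rule coherence_pos)
  show "0 < sub_coherence M"
  proof (rule ccontr)
    assume "\<not> 0 < sub_coherence M"
    then have "sub_coherence M = 0"
      using sub_coherence_nonneg[of M] by linarith
    then have prod: "1 \<le> (?\<mu> * ?\<alpha>) * (?\<mu> * ?\<beta>)"
      using quad(1) by (simp add: coherence_gap_def)
    have le1: "?\<mu> * ?\<alpha> \<le> 1"
      using rank \<mu> by (auto simp: field_simps)
    have "?\<beta> < ?\<alpha> \<or> ?\<mu> * ?\<alpha> < 1"
      using rank \<mu> by (auto simp: field_simps)
    moreover have "?\<mu> * ?\<beta> \<le> ?\<mu> * ?\<alpha>"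
      using quad(4) \<mu> by simp
    ultimately have lt1: "?\<mu> * ?\<beta> < 1"
      using le1 \<mu> by (smt (verit) mult_strict_left_mono)
    have "0 \<le> ?\<mu> * ?\<beta>"
      using \<mu> by simp
    then have "(?\<mu> * ?\<alpha>) * (?\<mu> * ?\<beta>) \<le> 1 * (?\<mu> * ?\<beta>)"
      using le1 by (rule mult_right_mono[rotated])
    with prod lt1 show False
      by linarith
  qed
qed

section \<open>Lower bounds for kernel supports\<close>

lemma kernel_support_ge_root:
  fixes M :: "real ^ 'n ^ 'm"
  assumes nz: "\<And>j. column j M \<noteq> 0" and z: "M *v z = 0" "z \<noteq> 0" and pos: "0 < sub_coherence M"
  shows "1 + 2 * (1 - real (coherence_rank M) * real (sub_coherence_rank M) * (coherence_gap M)\<^sup>2) /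
      (sub_coherence M *
        (coherence_gap M * (real (coherence_rank M) + real (sub_coherence_rank M)) +
         sqrt ((coherence_gap M * (real (coherence_rank M) - real (sub_coherence_rank M)))\<^sup>2 + 4)))
    \<le> real (l0_norm z)"
proof -
  note quad = kernel_support_quadratic[OF nz z]
  let ?\<delta> = "coherence_gap M" and ?\<alpha> = "real (coherence_rank M)"
    and ?\<beta> = "real (sub_coherence_rank M)"
  have num: "(?\<delta> * ?\<alpha>) * (?\<delta> * ?\<beta>) = ?\<alpha> * ?\<beta> * ?\<delta>\<^sup>2"
    by (simp add: power2_eq_square)
  have "2 * (1 - (?\<delta> * ?\<alpha>) * (?\<delta> * ?\<beta>)) /
      ((?\<delta> * ?\<alpha> + ?\<delta> * ?\<beta>) + sqrt ((?\<delta> * ?\<alpha> - ?\<delta> * ?\<beta>)\<^sup>2 + 4))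
      \<le> sub_coherence M * (real (l0_norm z) - 1)"
    using quad by (intro quadratic_root_le) auto
  then have root: "2 * (1 - ?\<alpha> * ?\<beta> * ?\<delta>\<^sup>2) /
      (?\<delta> * (?\<alpha> + ?\<beta>) + sqrt ((?\<delta> * (?\<alpha> - ?\<beta>))\<^sup>2 + 4))
      \<le> sub_coherence M * (real (l0_norm z) - 1)" (is "?N / ?D \<le> _")
    unfolding num by (simp only: distrib_left right_diff_distrib)
  have "?N / (sub_coherence M * ?D) = ?N / ?D / sub_coherence M"
    by (simp add: mult.commute)
  also have "\<dots> \<le> real (l0_norm z) - 1"
    using root pos by (simp only: pos_divide_le_eq mult.commute)
  finally show ?thesis
    by linarith
qed

text \<open>Since \<open>\<beta> \<le> \<alpha>\<close>, the larger factor \<open>\<nu> * t + \<delta> * \<alpha>\<close> of the quadratic is itself at least 1; the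
displayed bound is \<open>1 + (1 - \<delta> * \<alpha>) / \<nu>\<close> with \<open>\<delta> = \<mu> - \<nu>\<close> expanded.\<close>

lemma kernel_support_ge_linear:
  fixes M :: "real ^ 'n ^ 'm"
  assumes nz: "\<And>j. column j M \<noteq> 0" and z: "M *v z = 0" "z \<noteq> 0"
    and pos: "0 < sub_coherence M"
  shows "1 + 1 / coherence M +
      (1 / sub_coherence M - 1 / coherence M) * (1 - real (coherence_rank M) * coherence M)
    \<le> real (l0_norm z)"
proof -
  note quad = kernel_support_quadratic[OF nz z]
  let ?\<mu> = "coherence M" and ?\<nu> = "sub_coherence M" and ?\<delta> = "coherence_gap M"
    and ?\<alpha> = "real (coherence_rank M)" and ?\<beta> = "real (sub_coherence_rank M)"
    and ?t = "real (l0_norm z) - 1"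
  have "1 \<le> ?\<nu> * ?t + ?\<delta> * ?\<alpha>"
  proof (rule one_le_if_prod_ge_1[OF quad(1)])
    show "0 \<le> ?\<nu> * ?t + ?\<delta> * ?\<beta>"
      using quad(2,3) by simp
    show "?\<nu> * ?t + ?\<delta> * ?\<beta> \<le> ?\<nu> * ?t + ?\<delta> * ?\<alpha>"
      using quad(3,4) by (simp add: mult_left_mono)
  qed
  then have "(1 - ?\<delta> * ?\<alpha>) / ?\<nu> \<le> ?t"
    unfolding pos_divide_le_eq[OF pos] by (simp add: mult.commute)
  moreover have "1 / ?\<mu> + (1 / ?\<nu> - 1 / ?\<mu>) * (1 - ?\<alpha> * ?\<mu>) = (1 - ?\<delta> * ?\<alpha>) / ?\<nu>"
    using pos coherence_pos[OF nz z] by (simp add: coherence_gap_def field_simps)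
  ultimately show ?thesis
    by linarith
qed

section \<open>Unique sparsest solutions\<close>

theorem corollary4p7:
  fixes A M :: "real ^ 'n ^ 'm"
    and b :: "real ^ 'm"
    and \<phi> :: "real ^ 'm \<Rightarrow> real ^ 'm"
  assumes "2 \<le> CARD('m)"
    and "CARD('m) < CARD('n)"
    and "\<forall>j. column j A \<noteq> 0"
    and "\<forall>v i. 0 < \<phi> v $ i"
    and "M = diag_mat (\<phi> b) ** A"
  shows
    "(real (coherence_rank M) \<le> 1 / coherence M \<and> sub_coherence_rank M < coherence_rank M \<or>
      real (coherence_rank M) < 1 / coherence M \<longrightarrow>
        (\<forall>x. A *v x = b \<and>
          real (l0_norm x) < 1 / 2 * (1 +
            2 * (1 - real (coherence_rank M) * real (sub_coherence_rank M) * (coherence_gap M)\<^sup>2) /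
            (sub_coherence M *
              (coherence_gap M * (real (coherence_rank M) + real (sub_coherence_rank M)) +
               sqrt ((coherence_gap M * (real (coherence_rank M) - real (sub_coherence_rank M)))\<^sup>2 + 4))))
          \<longrightarrow> unique_sparsest_solution A b x) \<and>
        (\<forall>x. A *v x = b \<and>
          real (l0_norm x) < 1 / 2 * (1 + 1 / coherence M +
            (1 / sub_coherence M - 1 / coherence M) * (1 - real (coherence_rank M) * coherence M))
          \<longrightarrow> unique_sparsest_solution A b x)) \<and>
     (coherence M < 1 \<and> coherence_rank M = 1 \<longrightarrow>
        (\<forall>x. A *v x = b \<and>
          real (l0_norm x) < 1 / 2 * (1 + 1 / coherence M +
            (1 / sub_coherence M - 1 / coherence M) * (1 - coherence M))
          \<longrightarrow> unique_sparsest_solution A b x))"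
proof -
  let ?rank = "real (coherence_rank M) \<le> 1 / coherence M \<and> sub_coherence_rank M < coherence_rank M \<or>
    real (coherence_rank M) < 1 / coherence M"
  have M_vec: "M *v v = diag_mat (\<phi> b) *v (A *v v)" for v
    by (simp add: assms(5) matrix_vector_mul_assoc)
  have ker: "M *v v = 0 \<longleftrightarrow> A *v v = 0" for v
    using assms(4) by (simp add: M_vec diag_mat_mult_vec_eq_0_iff)
  have nz: "column j M \<noteq> 0" for j
    using assms(3) ker[of "axis j 1"] by (simp add: matrix_vector_mul_component matrix_vector_mult_basis)
  obtain z0 where z0: "M *v z0 = 0" "z0 \<noteq> 0"
    using matrix_nonfull_linear_equations_eq[of M] rank_bound[of M] assms(2) by force
  note \<mu>_pos = coherence_pos[OF nz z0]

  \<comment> \<open>A bound \<open>B\<close> below every kernel support certifies each solution sparser than half of it.\<close>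
  have unique: "\<forall>x. A *v x = b \<and> real (l0_norm x) < 1 / 2 * B \<longrightarrow> unique_sparsest_solution A b x"
    if "\<And>z. M *v z = 0 \<Longrightarrow> z \<noteq> 0 \<Longrightarrow> B \<le> real (l0_norm z)" for B
  proof (intro allI impI)
    fix x assume x: "A *v x = b \<and> real (l0_norm x) < 1 / 2 * B"
    then show "unique_sparsest_solution A b x"
      using that ker by (intro unique_sparsest_solution_if_kernel_supports_large) fastforce+
  qed
  have i: "(\<forall>x. A *v x = b \<and>
          real (l0_norm x) < 1 / 2 * (1 +
            2 * (1 - real (coherence_rank M) * real (sub_coherence_rank M) * (coherence_gap M)\<^sup>2) /
            (sub_coherence M *
              (coherence_gap M * (real (coherence_rank M) + real (sub_coherence_rank M)) +
               sqrt ((coherence_gap M * (real (coherence_rank M) - real (sub_coherence_rank M)))\<^sup>2 + 4))))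
          \<longrightarrow> unique_sparsest_solution A b x) \<and>
        (\<forall>x. A *v x = b \<and>
          real (l0_norm x) < 1 / 2 * (1 + 1 / coherence M +
            (1 / sub_coherence M - 1 / coherence M) * (1 - real (coherence_rank M) * coherence M))
          \<longrightarrow> unique_sparsest_solution A b x)"
    if ?rank
    using sub_coherence_pos[OF nz z0 that]
    by (intro conjI unique kernel_support_ge_root[OF nz] kernel_support_ge_linear[OF nz])
  have ii: "\<forall>x. A *v x = b \<and>
          real (l0_norm x) < 1 / 2 * (1 + 1 / coherence M +
            (1 / sub_coherence M - 1 / coherence M) * (1 - coherence M))
          \<longrightarrow> unique_sparsest_solution A b x"
    if "coherence M < 1 \<and> coherence_rank M = 1"
  proof -
    have ?rank
      using that \<mu>_pos by simp
    from i[OF this] that show ?thesis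
      by simp
  qed
  show ?thesis
    using i ii by blast
qed

end
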